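(* Let $n>1$ be an integer. The following are equivalent: (a) for every real $k$ with $0\leq k\leq 1$ and all positive real numbers $x_1,\ldots,x_n$, $$\sum_{i=1}^{n}\left(\frac{x_i}{x_{i+1}+x_{i+2}}\right)^k\geq\frac{n}{2};$$ (b) the original Shapiro inequality holds in dimension $n$, i.e. for all positive real numbers $x_1,\ldots,x_n$, $$\sum_{i=1}^{n}\frac{x_i}{x_{i+1}+x_{i+2}}\geq\frac{n}{2}.$$
   Context: Indices of the variables are understood cyclically modulo $n$, i.e. $x_{j+n}=x_j$ for every integer $j$. *)

theory Defs
  imports Complex_Main
begin

(* A tuple x_1, ..., x_n of positive reals with indices read modulo n is a
   function on all integers that is n-periodic and positive on 1, ..., n. *)
definition cyclic_pos :: "int \<Rightarrow> (int \<Rightarrow> real) \<Rightarrow> bool" where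
  "cyclic_pos n x \<longleftrightarrow> (\<forall>j. x (j + n) = x j) \<and> (\<forall>i\<in>{1..n}. x i > 0)"

end

theory Submission
  imports Defs
begin

text \<open>For \<open>0 \<le> k \<le> 1\<close> the map \<open>t \<mapsto> t powr k\<close> is subadditive, so each summand
  \<open>(x / (y + z)) powr k\<close> is at least \<open>u / (v + w)\<close> for the \<open>k\<close>-th powers \<open>u, v, w\<close> of
  \<open>x, y, z\<close>. Thus Shapiro's inequality for the tuple of \<open>k\<close>-th powers gives the inequality with
  exponent \<open>k\<close>.\<close>

text \<open>Writing \<open>t powr k\<close> as \<open>t * t powr (k - 1)\<close> leaves an exponent
  \<open>k - 1 \<le> 0\<close>, so the second factor is decreasing in \<open>t\<close> and only
  grows when \<open>y + z\<close> is replaced by \<open>y\<close> or by \<open>z\<close>.\<close>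

lemma powr_add_le:
  fixes y z k :: real
  assumes "y > 0" "z > 0" "k \<le> 1"
  shows "(y + z) powr k \<le> y powr k + z powr k"
proof -
  have split: "t powr k = t * t powr (k - 1)" if "t > 0" for t :: real
    using that by (simp add: powr_mult_base)
  have "(y + z) powr k = y * (y + z) powr (k - 1) + z * (y + z) powr (k - 1)"
    using split[of "y + z"] assms by (simp add: distrib_right)
  also have "\<dots> \<le> y * y powr (k - 1) + z * z powr (k - 1)"
    using assms by (intro add_mono mult_left_mono powr_mono2') auto
  finally show ?thesis
    using split assms by simp
qed

text \<open>Positivity is given only on \<open>{1..n}\<close>, but the denominators reach index
  \<open>n + 2\<close>. Since \<open>n > 1\<close>, one shift by \<open>n\<close> brings
  \<open>n + 1\<close> and \<open>n + 2\<close> back to 1 and 2, which lie in the range.\<close>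

lemma cyclic_pos_shift:
  assumes "n > 1" "cyclic_pos n x" "i \<in> {1..n}"
  shows "x i > 0" "x (i + 1) > 0" "x (i + 2) > 0"
proof -
  have per: "x (j + n) = x j" for j
    using assms(2) by (simp add: cyclic_pos_def)
  have pos: "x j > 0" if "1 \<le> j" "j \<le> n" for j
    using assms(2) that by (simp add: cyclic_pos_def)
  have "x j > 0" if "1 \<le> j" "j \<le> n + 2" for j
    using pos[of j] pos[of "j - n"] per[of "j - n"] that assms(1) by (cases "j \<le> n") auto
  then show "x i > 0" "x (i + 1) > 0" "x (i + 2) > 0"
    using assms(3) by auto
qed

theorem proposition3p4:
  fixes n :: int
  assumes "n > 1"
  shows "(\<forall>k::real. 0 \<le> k \<and> k \<le> 1 \<longrightarrow>
            (\<forall>x. cyclic_pos n x \<longrightarrow>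
              (\<Sum>i=1..n. (x i / (x (i + 1) + x (i + 2))) powr k) \<ge> real_of_int n / 2))
       \<longleftrightarrow> (\<forall>x. cyclic_pos n x \<longrightarrow>
              (\<Sum>i=1..n. x i / (x (i + 1) + x (i + 2))) \<ge> real_of_int n / 2)"
    (is "?A \<longleftrightarrow> ?B")
proof
  assume A: ?A
  show ?B
  proof (intro allI impI)
    fix x assume x: "cyclic_pos n x"
    have "real_of_int n / 2 \<le> (\<Sum>i=1..n. (x i / (x (i + 1) + x (i + 2))) powr 1)"
      using A x by (meson order_refl zero_le_one)
    \<comment> \<open>The rule \<open>powr_one\<close> asks for a nonnegative base, which is where
      positivity enters.\<close>
    also have "\<dots> = (\<Sum>i=1..n. x i / (x (i + 1) + x (i + 2)))"
      using cyclic_pos_shift[OF assms x]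
      by (intro sum.cong refl powr_one divide_nonneg_nonneg add_nonneg_nonneg less_imp_le)
    finally show "(\<Sum>i=1..n. x i / (x (i + 1) + x (i + 2))) \<ge> real_of_int n / 2" .
  qed
next
  assume B: ?B
  show ?A
  proof (intro allI impI)
    fix k :: real and x
    assume k: "0 \<le> k \<and> k \<le> 1" and x: "cyclic_pos n x"
    define y where "y j = x j powr k" for j
    have "cyclic_pos n y"
      using x by (fastforce simp: cyclic_pos_def y_def)
    with B have "real_of_int n / 2 \<le> (\<Sum>i=1..n. y i / (y (i + 1) + y (i + 2)))"
      by blast
    also have "\<dots> \<le> (\<Sum>i=1..n. (x i / (x (i + 1) + x (i + 2))) powr k)"
    proof (rule sum_mono)
      fix i assume "i \<in> {1..n}"
      note pos = cyclic_pos_shift[OF assms x this]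
      \<comment> \<open>Both numerators are \<open>x i powr k\<close>; subadditivity makes the left
        denominator the larger one.\<close>
      have "y i / (y (i + 1) + y (i + 2)) \<le> x i powr k / (x (i + 1) + x (i + 2)) powr k"
        unfolding y_def using pos k by (intro divide_left_mono powr_add_le mult_pos_pos add_pos_pos) auto
      also have "\<dots> = (x i / (x (i + 1) + x (i + 2))) powr k"
        using pos by (simp add: powr_divide)
      finally show "y i / (y (i + 1) + y (i + 2)) \<le> (x i / (x (i + 1) + x (i + 2))) powr k" .
    qed
    finally show "(\<Sum>i=1..n. (x i / (x (i + 1) + x (i + 2))) powr k) \<ge> real_of_int n / 2" .
  qed
qed

end
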